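(* (Stationary distribution for regulated Brownian bridge.) Let $\theta>0$, $\tau>0$, $\rho\in\mathbb R$, $v\ge0$, and let $$F_{0;\vec0,v}(t;q)=\frac12\left(1-e^{\frac{-2q(\tau q-\theta\rho)}{\theta^2}}-\mathrm{erf}\!\left(\frac{-q+v+\rho t}{\sqrt{2t(\theta-\tau t)}}\right)+e^{\frac{-2q(\tau q-\theta\rho)}{\theta^2}}\,\mathrm{erf}\!\left(\frac{\theta(q+v)-(2\tau q-\theta\rho)t}{\theta\sqrt{2t(\theta-\tau t)}}\right)\right),\quad 0<t<\theta/\tau,$$ be the distribution function $P(Q(t)\le q)$ of the regulated Brownian bridge $Q$ described in the context. Then $$\vec F(q)\equiv\lim_{t\to\theta/\tau}F_{0;\vec0,v}(t;q)=1-e^{-2q(\tau q-\theta\rho)/\theta^2}.$$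
   Context: A $(\theta,\tau)$ GMSI process on $[0,\Delta)$ (where $0<\Delta\le\infty$, $\theta>0$, $\tau\le\theta/\Delta$) is a real, continuous, zero-mean Gaussian Markov process $X$ with $X(0)=0$, stationary increments, and covariance $E[X(s)X(t)]=s(\theta-\tau t)$ for $0\le s\le t<\Delta$. When $\tau>0$ and $\Delta=\theta/\tau$, $X$ is called a scaled Brownian bridge. Regulated Brownian bridge: $Q(t)=Q(0)+Z(t)+L(t)$ with $Q(0)=v$ and $Z(t)=\rho t+X(t)$, where $X$ is a $(\theta,\tau)$ GMSI process on $[0,\Delta)$ with $\tau>0$ and $\Delta=\theta/\tau$, and $L$ is a non-decreasing continuous function with $L(0)=0$ that increases only when $Q=0$, such that $Q(t)\ge0$ for all $0\le t<\Delta$. (In general $X=\sum_{i=1}^Kk_iX^{(i)}$ may be a superposition of independent $(\theta^{(i)},\tau^{(i)})$ GMSI processes, with $\theta=\sum_ik_i^2\theta^{(i)}$ and $\tau=\sum_ik_i^2\tau^{(i)}$; the subscript $0;\vec0$ indicates that all $X^{(i)}(0)=0$ at time $0$.) $\mathrm{erf}(z)=2\pi^{-1/2}\int_0^z e^{-t^2}\,dt$.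
   Formalization: The limit is claimed for q ≥ 0 with q > v+ρθ/τ, q = 0 or τq = θρ; otherwise it fails: for θ=τ=1, ρ=0, v=1, q=1/2 the limit of F is 0, not 1−e^{−1/2}. *)

theory Defs
  imports "HOL-Probability.Probability"
begin

definition erf :: "real \<Rightarrow> real" where
  "erf z = 2 / sqrt pi * (LBINT t=ereal 0..ereal z. exp (- (t\<^sup>2)))"

(* Point masses count as (degenerate) Gaussians, as is needed for X(0) = 0. *)
definition gaussian_rv :: "'a measure \<Rightarrow> ('a \<Rightarrow> real) \<Rightarrow> bool" where
  "gaussian_rv M Y \<longleftrightarrow> Y \<in> borel_measurable M \<and>
     ((\<exists>c. AE \<omega> in M. Y \<omega> = c) \<or>
      (\<exists>\<mu> \<sigma>. \<sigma> > 0 \<and> distributed M lborel Y (\<lambda>x. ennreal (normal_density \<mu> \<sigma> x))))"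

definition gaussian_process :: "'a measure \<Rightarrow> real set \<Rightarrow> (real \<Rightarrow> 'a \<Rightarrow> real) \<Rightarrow> bool" where
  "gaussian_process M I X \<longleftrightarrow>
     (\<forall>J c. finite J \<longrightarrow> J \<subseteq> I \<longrightarrow> gaussian_rv M (\<lambda>\<omega>. \<Sum>t\<in>J. c t * X t \<omega>))"

definition past_algebra ::
    "'a measure \<Rightarrow> real set \<Rightarrow> (real \<Rightarrow> 'a \<Rightarrow> real) \<Rightarrow> real \<Rightarrow> 'a measure" where
  "past_algebra M I X s =
     sigma (space M) {X u -` A \<inter> space M | u A. u \<in> I \<and> u \<le> s \<and> A \<in> sets borel}"

definition markov_process :: "'a measure \<Rightarrow> real set \<Rightarrow> (real \<Rightarrow> 'a \<Rightarrow> real) \<Rightarrow> bool" where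
  "markov_process M I X \<longleftrightarrow>
     (\<forall>s\<in>I. \<forall>t\<in>I. \<forall>A\<in>sets borel. s \<le> t \<longrightarrow>
        (AE \<omega> in M.
           real_cond_exp M (past_algebra M I X s) (indicator (X t -` A \<inter> space M)) \<omega> =
           real_cond_exp M (vimage_algebra (space M) (X s) borel)
             (indicator (X t -` A \<inter> space M)) \<omega>))"

definition stationary_increments ::
    "'a measure \<Rightarrow> real set \<Rightarrow> (real \<Rightarrow> 'a \<Rightarrow> real) \<Rightarrow> bool" where
  "stationary_increments M I X \<longleftrightarrow>
     (\<forall>J h. finite J \<longrightarrow> J \<subseteq> I \<longrightarrow> h \<in> I \<longrightarrow> (\<forall>t\<in>J. t + h \<in> I) \<longrightarrow>
        distr M (PiM J (\<lambda>_. borel)) (\<lambda>\<omega>. \<lambda>t\<in>J. X (t + h) \<omega> - X h \<omega>) =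
        distr M (PiM J (\<lambda>_. borel)) (\<lambda>\<omega>. \<lambda>t\<in>J. X t \<omega> - X 0 \<omega>))"

definition time_range :: "ereal \<Rightarrow> real set" where
  "time_range \<Delta> = {t. 0 \<le> t \<and> ereal t < \<Delta>}"

locale gmsi_process = prob_space M
  for M :: "'a measure" and \<Delta> :: ereal and \<theta> \<tau> :: real and X :: "real \<Rightarrow> 'a \<Rightarrow> real" +
  assumes \<Delta>_pos: "0 < \<Delta>"
    and \<theta>_pos: "0 < \<theta>"
    and \<tau>_le: "ereal \<tau> \<le> ereal \<theta> / \<Delta>"  \<comment> \<open>for \<open>\<Delta> = \<infinity>\<close> the bound is \<open>0\<close>\<close>
    and X_measurable: "\<And>t. t \<in> time_range \<Delta> \<Longrightarrow> X t \<in> borel_measurable M"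
    and X_zero: "AE \<omega> in M. X 0 \<omega> = 0"
    and X_continuous: "AE \<omega> in M. continuous_on (time_range \<Delta>) (\<lambda>t. X t \<omega>)"
    and X_gaussian: "gaussian_process M (time_range \<Delta>) X"
    and X_markov: "markov_process M (time_range \<Delta>) X"
    and X_stationary_increments: "stationary_increments M (time_range \<Delta>) X"
    and X_mean: "\<And>t. t \<in> time_range \<Delta> \<Longrightarrow> expectation (X t) = 0"
    and X_covariance: "\<And>s t. 0 \<le> s \<Longrightarrow> s \<le> t \<Longrightarrow> ereal t < \<Delta> \<Longrightarrow>
           expectation (\<lambda>\<omega>. X s \<omega> * X t \<omega>) = s * (\<theta> - \<tau> * t)"

text \<open>
  The assumption \<open>L_flat\<close> says that the regulator increases only when \<open>Q = 0\<close>: it is constant on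
  every interval on which \<open>Q\<close> is positive.
\<close>

locale regulated_brownian_bridge = gmsi_process M "ereal (\<theta> / \<tau>)" \<theta> \<tau> X
  for M :: "'a measure" and \<theta> \<tau> :: real and X :: "real \<Rightarrow> 'a \<Rightarrow> real" +
  fixes \<rho> v :: real and Q L :: "real \<Rightarrow> 'a \<Rightarrow> real"
  assumes \<tau>_pos: "0 < \<tau>"
    and v_nonneg: "0 \<le> v"
    and Q_measurable: "\<And>t. 0 \<le> t \<Longrightarrow> t < \<theta> / \<tau> \<Longrightarrow> Q t \<in> borel_measurable M"
    and Q_initial: "AE \<omega> in M. Q 0 \<omega> = v"
    and Q_eq: "AE \<omega> in M. \<forall>t\<in>{0..<\<theta> / \<tau>}. Q t \<omega> = Q 0 \<omega> + (\<rho> * t + X t \<omega>) + L t \<omega>"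
    and Q_nonneg: "AE \<omega> in M. \<forall>t\<in>{0..<\<theta> / \<tau>}. 0 \<le> Q t \<omega>"
    and L_zero: "AE \<omega> in M. L 0 \<omega> = 0"
    and L_mono: "AE \<omega> in M. mono_on {0..<\<theta> / \<tau>} (\<lambda>t. L t \<omega>)"
    and L_continuous: "AE \<omega> in M. continuous_on {0..<\<theta> / \<tau>} (\<lambda>t. L t \<omega>)"
    and L_flat: "AE \<omega> in M. \<forall>s t. 0 \<le> s \<longrightarrow> s \<le> t \<longrightarrow> t < \<theta> / \<tau> \<longrightarrow>
           (\<forall>u\<in>{s..t}. 0 < Q u \<omega>) \<longrightarrow> L s \<omega> = L t \<omega>"

definition regulated_bridge_cdf ::
    "real \<Rightarrow> real \<Rightarrow> real \<Rightarrow> real \<Rightarrow> real \<Rightarrow> real \<Rightarrow> real" where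
  "regulated_bridge_cdf \<theta> \<tau> \<rho> v t q =
     1 / 2 * (1 - exp (- 2 * q * (\<tau> * q - \<theta> * \<rho>) / \<theta>\<^sup>2)
       - erf ((- q + v + \<rho> * t) / sqrt (2 * t * (\<theta> - \<tau> * t)))
       + exp (- 2 * q * (\<tau> * q - \<theta> * \<rho>) / \<theta>\<^sup>2)
         * erf ((\<theta> * (q + v) - (2 * \<tau> * q - \<theta> * \<rho>) * t)
                / (\<theta> * sqrt (2 * t * (\<theta> - \<tau> * t)))))"

end

(* Both error functions have arguments with numerators tending to c = v + rho * theta / tau - q
   and the same denominator tending to 0 from above. For c < 0 both tend to -1, which gives the
   claim. If q = 0 or tau * q = theta * rho, the exponential is 1, and it suffices that the two
   error functions have the same limit; in the second case c = v, and for v = 0 the numerators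
   vanish to first order while the denominator is of order 1/2, so both arguments tend to 0. *)

theory Submission
  imports Defs
begin

lemma erf_0: "erf 0 = 0"
  by (simp add: erf_def zero_ereal_def[symmetric])

lemma erf_minus: "erf (- z) = - erf z"
proof -
  have "(LBINT t=ereal 0..ereal (- z). exp (- (t\<^sup>2)))
      = (LBINT t=ereal z..ereal 0. exp (- ((- t)\<^sup>2)))"
    by (subst interval_integral_reflect) (simp add: zero_ereal_def)
  also have "\<dots> = - (LBINT t=ereal 0..ereal z. exp (- (t\<^sup>2)))"
    by (subst interval_integral_endpoints_reverse) simp
  finally show ?thesis
    by (simp add: erf_def)
qed

text \<open>The integral is differentiable in its upper endpoint by the fundamental theorem of
  calculus, hence continuous.\<close>

lemma isCont_erf: "isCont erf x"
proof -
  \<comment> \<open>The interval from \<open>a\<close> to \<open>b\<close> has to contain the base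
    point 0 of the integral and to have \<open>x\<close> in its interior, so that the derivative
    within it is a full derivative at \<open>x\<close>.\<close>
  define a where "a = min 0 x - 1"
  define b where "b = max 0 x + 1"
  have bnds: "a \<le> 0" "0 \<le> b" "a < x" "x < b"
    by (auto simp: a_def b_def)
  have "((\<lambda>u. LBINT t=ereal 0..ereal u. exp (- (t\<^sup>2))) has_vector_derivative exp (- (x\<^sup>2)))
      (at x within {a..b})"
    using bnds by (intro interval_integral_FTC2) (auto intro!: continuous_intros)
  hence "((\<lambda>u. LBINT t=ereal 0..ereal u. exp (- (t\<^sup>2))) has_vector_derivative exp (- (x\<^sup>2)))
      (at x)"
    using at_within_Icc_at[of a x b] bnds by simp
  hence "isCont (\<lambda>u. LBINT t=ereal 0..ereal u. exp (- (t\<^sup>2))) x"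
    by (rule has_vector_derivative_continuous)
  thus ?thesis
    unfolding erf_def[abs_def] by (intro continuous_intros)
qed

text \<open>The Gaussian integral over the half-line is \<open>sqrt pi / 2\<close>, which the
  normalising factor of \<open>erf\<close> cancels.\<close>

lemma erf_at_top: "(erf \<longlongrightarrow> 1) at_top"
proof -
  have hb: "has_bochner_integral lborel (\<lambda>x. indicator {0..} x *\<^sub>R exp (- x\<^sup>2 :: real)) (sqrt pi / 2)"
    using gaussian_moment_0 .
  hence si: "set_integrable lborel {0..} (\<lambda>x. exp (- x\<^sup>2 :: real))"
    and val: "set_lebesgue_integral lborel {0..} (\<lambda>x. exp (- x\<^sup>2 :: real)) = sqrt pi / 2"
    by (auto simp: has_bochner_integral_iff set_integrable_def set_lebesgue_integral_def)
  have "((\<lambda>b. set_lebesgue_integral lborel {0..b} (\<lambda>x. exp (- x\<^sup>2 :: real))) \<longlongrightarrow> sqrt pi / 2) at_top"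
    using tendsto_set_lebesgue_integral_at_top[OF _ si] val by simp
  hence "((\<lambda>z. 2 / sqrt pi * set_lebesgue_integral lborel {0..z} (\<lambda>x. exp (- x\<^sup>2 :: real)))
      \<longlongrightarrow> 2 / sqrt pi * (sqrt pi / 2)) at_top"
    by (intro tendsto_intros)
  moreover have "eventually (\<lambda>z. 2 / sqrt pi * set_lebesgue_integral lborel {0..z} (\<lambda>x. exp (- x\<^sup>2 :: real)) = erf z) at_top"
    using eventually_ge_at_top[of 0]
    by eventually_elim (simp add: erf_def interval_integral_Icc)
  ultimately show ?thesis
    by (simp add: tendsto_cong)
qed

lemma erf_at_bot: "(erf \<longlongrightarrow> - 1) at_bot"
proof -
  have "((\<lambda>z. - erf (- z)) \<longlongrightarrow> - 1) at_bot"
    by (intro tendsto_minus filterlim_compose[OF erf_at_top] filterlim_uminus_at_top_at_bot)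
  thus ?thesis
    by (simp add: erf_minus)
qed

text \<open>Since \<open>g\<close> tends to 0 through positive values, its inverse tends to plus
  infinity, and the sign of \<open>c\<close> decides the direction of the quotient.\<close>

lemma filterlim_divide_at_top:
  fixes f g :: "'a \<Rightarrow> real"
  assumes "(f \<longlongrightarrow> c) F" "0 < c" "filterlim g (at_right 0) F"
  shows "filterlim (\<lambda>x. f x / g x) at_top F"
  unfolding divide_inverse
  using assms by (intro filterlim_tendsto_pos_mult_at_top[of f c]
      filterlim_compose[OF filterlim_inverse_at_top_right]) auto

lemma filterlim_divide_at_bot:
  fixes f g :: "'a \<Rightarrow> real"
  assumes "(f \<longlongrightarrow> c) F" "c < 0" "filterlim g (at_right 0) F"
  shows "filterlim (\<lambda>x. f x / g x) at_bot F"
  unfolding divide_inverse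
  using assms by (intro filterlim_tendsto_neg_mult_at_bot[of f c]
      filterlim_compose[OF filterlim_inverse_at_top_right]) auto

text \<open>The disjunction \<open>q\<close> marks out where the claimed value is right. With c = v
  + \<rho> \<theta> / \<tau> - q, the formula tends to 0 if c > 0 and to half of the claimed value
  if c = 0. These agree with the claim only if the exponential is 1, which is what the last two
  disjuncts say.\<close>

lemma regulated_bridge_cdf_tendsto:
  assumes "0 < \<theta>" "0 < \<tau>" "0 \<le> v"
    and q: "v + \<rho> * (\<theta> / \<tau>) < q \<or> q = 0 \<or> \<tau> * q = \<theta> * \<rho>"
  shows "((\<lambda>t. regulated_bridge_cdf \<theta> \<tau> \<rho> v t q)
            \<longlongrightarrow> 1 - exp (- 2 * q * (\<tau> * q - \<theta> * \<rho>) / \<theta>\<^sup>2)) (at_left (\<theta> / \<tau>))"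
proof -
  let ?F = "at_left (\<theta> / \<tau>)"
  define e where "e = exp (- 2 * q * (\<tau> * q - \<theta> * \<rho>) / \<theta>\<^sup>2)"
  define d where "d t = sqrt (2 * t * (\<theta> - \<tau> * t))" for t
  define m where "m t = - q + v + \<rho> * t" for t
  \<comment> \<open>Cancelling \<theta> in the second argument gives both arguments the denominator
    \<open>d t\<close>, and both numerators the limit \<open>c\<close>.\<close>
  define n where "n t = q + v - (2 * \<tau> * q - \<theta> * \<rho>) * t / \<theta>" for t
  define c where "c = v + \<rho> * (\<theta> / \<tau>) - q"
  have cdf: "regulated_bridge_cdf \<theta> \<tau> \<rho> v t q
      = 1 / 2 * (1 - e - erf (m t / d t) + e * erf (n t / d t))" for t
  proof -
    have "n t / d t = (\<theta> * (q + v) - (2 * \<tau> * q - \<theta> * \<rho>) * t) / (\<theta> * d t)"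
      using assms(1) by (simp add: n_def divide_simps)
    thus ?thesis
      unfolding regulated_bridge_cdf_def e_def d_def m_def by simp
  qed
  have pos: "eventually (\<lambda>t. 0 < t \<and> t < \<theta> / \<tau>) ?F"
    using assms by (intro eventually_at_leftI[of 0]) auto
  have d_lim: "filterlim d (at_right 0) ?F"
    unfolding filterlim_at
  proof
    show "eventually (\<lambda>t. d t \<in> {0<..} \<and> d t \<noteq> 0) ?F"
      using pos by eventually_elim (use assms in \<open>auto simp: d_def field_simps\<close>)
    have "((\<lambda>t. sqrt (2 * t * (\<theta> - \<tau> * t))) \<longlongrightarrow> sqrt (2 * (\<theta> / \<tau>) * (\<theta> - \<tau> * (\<theta> / \<tau>)))) ?F"
      by (intro tendsto_intros)
    thus "(d \<longlongrightarrow> 0) ?F"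
      using assms by (simp add: d_def[abs_def])
  qed
  have m_lim: "(m \<longlongrightarrow> c) ?F"
  proof -
    have "(m \<longlongrightarrow> - q + v + \<rho> * (\<theta> / \<tau>)) ?F"
      unfolding m_def[abs_def] by (intro tendsto_intros)
    thus ?thesis
      by (simp add: c_def algebra_simps)
  qed
  have n_lim: "(n \<longlongrightarrow> c) ?F"
  proof -
    have "(n \<longlongrightarrow> q + v - (2 * \<tau> * q - \<theta> * \<rho>) * (\<theta> / \<tau>) / \<theta>) ?F"
      unfolding n_def[abs_def] using assms by (intro tendsto_intros) auto
    moreover have "q + v - (2 * \<tau> * q - \<theta> * \<rho>) * (\<theta> / \<tau>) / \<theta> = c"
      using assms(1,2) by (simp add: c_def field_simps)
    ultimately show ?thesis
      by simp
  qed
  \<comment> \<open>The limit here factors as (1 - e)(1 - l) / 2, so it equals 1 - e exactly when l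
    = -1 or e = 1.\<close>
  have lim: "((\<lambda>t. 1 / 2 * (1 - e - erf (m t / d t) + e * erf (n t / d t)))
      \<longlongrightarrow> 1 / 2 * (1 - e - l + e * l)) ?F"
    if "((\<lambda>t. erf (m t / d t)) \<longlongrightarrow> l) ?F" "((\<lambda>t. erf (n t / d t)) \<longlongrightarrow> l) ?F" for l
    by (intro tendsto_intros that)
  \<comment> \<open>If \<tau> q = \<theta> \<rho>, then \<rho> \<theta> / \<tau> = q and so c = v;
    the sign of \<open>v\<close> separates the last two cases.\<close>
  consider "c < 0" | "q = 0" | "\<tau> * q = \<theta> * \<rho>" "0 < v" | "\<tau> * q = \<theta> * \<rho>" "v = 0"
    using q \<open>0 \<le> v\<close> by (force simp: c_def)
  thus ?thesis
    unfolding cdf e_def[symmetric]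
  proof cases
    case 1
    have "((\<lambda>t. erf (m t / d t)) \<longlongrightarrow> - 1) ?F" "((\<lambda>t. erf (n t / d t)) \<longlongrightarrow> - 1) ?F"
      by (rule filterlim_compose[OF erf_at_bot filterlim_divide_at_bot] m_lim n_lim d_lim 1)+
    moreover have "1 / 2 * (1 - e - (- 1) + e * (- 1)) = 1 - e"
      by (simp add: field_simps)
    ultimately show "((\<lambda>t. 1 / 2 * (1 - e - erf (m t / d t) + e * erf (n t / d t)))
      \<longlongrightarrow> 1 - e) ?F"
      using lim[of "- 1"] by metis
  next
    case 2
    \<comment> \<open>The two error functions cancel at every \<open>t\<close>, so no limit of
      either is needed.\<close>
    hence "e = 1" "n = m"
      using assms(1) by (auto simp: e_def m_def n_def fun_eq_iff)
    thus "((\<lambda>t. 1 / 2 * (1 - e - erf (m t / d t) + e * erf (n t / d t))) \<longlongrightarrow> 1 - e) ?F"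
      by simp
  next
    case 3
    have "c = v" "e = 1"
      using 3 assms(2) by (auto simp: c_def e_def field_simps)
    hence "0 < c"
      using 3 by simp
    have "((\<lambda>t. erf (m t / d t)) \<longlongrightarrow> 1) ?F" "((\<lambda>t. erf (n t / d t)) \<longlongrightarrow> 1) ?F"
      by (rule filterlim_compose[OF erf_at_top filterlim_divide_at_top] m_lim n_lim d_lim \<open>0 < c\<close>)+
    from lim[OF this] show "((\<lambda>t. 1 / 2 * (1 - e - erf (m t / d t) + e * erf (n t / d t)))
      \<longlongrightarrow> 1 - e) ?F"
      using \<open>e = 1\<close> by simp
  next
    case 4
    have "e = 1"
      using 4 by (simp add: e_def)
    have \<rho>: "\<rho> = \<tau> * q / \<theta>"
      using 4 assms(1) by (simp add: field_simps)
    \<comment> \<open>As \<open>erf\<close> is odd, only the limit of \<open>m t / d t\<close>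
      remains to be found.\<close>
    have nm: "n t = - m t" for t
      using 4 assms(1) by (simp add: n_def m_def field_simps)
    \<comment> \<open>Here \<open>m t\<close> is -(q / \<theta>) times \<theta> - \<tau> t, and the
      square of \<open>d t\<close> is 2 t (\<theta> - \<tau> t). Dividing turns the 0/0 quotient
      \<open>m t / d t\<close> into this expression, whose denominator stays away from 0.\<close>
    have "((\<lambda>t. - (q / \<theta>) * (d t / (2 * t))) \<longlongrightarrow> - (q / \<theta>) * (0 / (2 * (\<theta> / \<tau>)))) ?F"
      using d_lim assms by (intro tendsto_intros) (auto simp: filterlim_at)
    moreover have "eventually (\<lambda>t. - (q / \<theta>) * (d t / (2 * t)) = m t / d t) ?F"
      using pos
    proof eventually_elim
      case (elim t)
      hence "0 < d t" "(d t)\<^sup>2 = 2 * t * (\<theta> - \<tau> * t)"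
        using assms by (auto simp: d_def field_simps)
      hence "d t / (2 * t) = (\<theta> - \<tau> * t) / d t"
        using elim by (simp add: field_simps power2_eq_square)
      moreover have "m t = - (q / \<theta>) * (\<theta> - \<tau> * t)"
        using 4(2) assms(1) by (simp add: m_def \<rho> field_simps)
      ultimately show ?case
        by simp
    qed
    ultimately have "((\<lambda>t. m t / d t) \<longlongrightarrow> 0) ?F"
      by (simp add: tendsto_cong)
    hence "((\<lambda>t. erf (m t / d t)) \<longlongrightarrow> 0) ?F"
      using isCont_tendsto_compose[OF isCont_erf, of _ 0] by (simp add: erf_0)
    moreover from this have "((\<lambda>t. erf (n t / d t)) \<longlongrightarrow> 0) ?F"
      using tendsto_minus by (fastforce simp: nm erf_minus)
    ultimately show "((\<lambda>t. 1 / 2 * (1 - e - erf (m t / d t) + e * erf (n t / d t)))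
      \<longlongrightarrow> 1 - e) ?F"
      using lim[of 0] \<open>e = 1\<close> by simp
  qed
qed

theorem corollary3:
  fixes \<theta> \<tau> \<rho> v q :: real
    and M :: "'a measure" and X Q L :: "real \<Rightarrow> 'a \<Rightarrow> real"
  assumes "0 < \<theta>" and "0 < \<tau>" and "0 \<le> v" and "0 \<le> q"
    and "v + \<rho> * (\<theta> / \<tau>) < q \<or> q = 0 \<or> \<tau> * q = \<theta> * \<rho>"
  shows "((\<lambda>t. regulated_bridge_cdf \<theta> \<tau> \<rho> v t q)
            \<longlongrightarrow> 1 - exp (- 2 * q * (\<tau> * q - \<theta> * \<rho>) / \<theta>\<^sup>2)) (at_left (\<theta> / \<tau>))
       \<and> (regulated_brownian_bridge M \<theta> \<tau> X \<rho> v Q L \<longrightarrow>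
          (\<forall>t\<in>{0<..<\<theta> / \<tau>}. \<forall>y\<ge>0.
             \<P>(\<omega> in M. Q t \<omega> \<le> y) = regulated_bridge_cdf \<theta> \<tau> \<rho> v t y) \<longrightarrow>
          ((\<lambda>t. \<P>(\<omega> in M. Q t \<omega> \<le> q))
             \<longlongrightarrow> 1 - exp (- 2 * q * (\<tau> * q - \<theta> * \<rho>) / \<theta>\<^sup>2)) (at_left (\<theta> / \<tau>)))"
proof (intro conjI impI)
  show cdf: "((\<lambda>t. regulated_bridge_cdf \<theta> \<tau> \<rho> v t q)
            \<longlongrightarrow> 1 - exp (- 2 * q * (\<tau> * q - \<theta> * \<rho>) / \<theta>\<^sup>2)) (at_left (\<theta> / \<tau>))"
    using regulated_bridge_cdf_tendsto assms by blast
  assume eq: "\<forall>t\<in>{0<..<\<theta> / \<tau>}. \<forall>y\<ge>0.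
             \<P>(\<omega> in M. Q t \<omega> \<le> y) = regulated_bridge_cdf \<theta> \<tau> \<rho> v t y"
  have "eventually (\<lambda>t. t \<in> {0<..<\<theta> / \<tau>}) (at_left (\<theta> / \<tau>))"
    using assms by (intro eventually_at_leftI[of 0]) auto
  \<comment> \<open>The premise on the distribution of \<open>Q t\<close>, taken at y = q, holds on
    the open interval where \<open>t\<close> eventually lies, so the left limit carries over to the
    probabilities.\<close>
  hence "eventually (\<lambda>t. regulated_bridge_cdf \<theta> \<tau> \<rho> v t q = \<P>(\<omega> in M. Q t \<omega> \<le> q)) (at_left (\<theta> / \<tau>))"
    by eventually_elim (use eq assms(4) in auto)
  thus "((\<lambda>t. \<P>(\<omega> in M. Q t \<omega> \<le> q))
             \<longlongrightarrow> 1 - exp (- 2 * q * (\<tau> * q - \<theta> * \<rho>) / \<theta>\<^sup>2)) (at_left (\<theta> / \<tau>))"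
    by (rule Lim_transform_eventually[OF cdf])
qed

end
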